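(* Let $i\in\{0,1,2,\dots\}$, let $x_0,\hat x_0\in(l,r]$, and put $x_i=\min(x_0,\hat x_0)$. Let $P_i$ and $P_{i+1}=f\,P_i/P_i'$ be the iterates defined in the context. (i) If $P_i$ is an upper bound on $F$ on $(l,x_0)$ in the sense of the context, and $P_i'(x)>0$ for all $x\in(l,\hat x_0)$, then $$P_{i+1}(x)\le P_i(x)\qquad\text{for all }x\in(l,x_i).$$ (ii) If $P_i$ is a lower bound on $F$ on $(l,x_0)$ in the sense of the context, and $P_i'(x)>0$ for all $x\in(l,\hat x_0)$, then $$P_{i+1}(x)\ge P_i(x)\qquad\text{for all }x\in(l,x_i).$$
   Context: $X$ is a continuous real random variable with cumulative distribution function $F(x)=\Pr\{X\le x\}$ and probability density function $f(x)=F'(x)$. The support of $f$ is an interval with endpoints $l$ and $r$, $-\infty\le l<r\le\infty$, each endpoint being included or not. The density $f$ is continuous on the support and its derivative $f'$ exists there; all functions are assumed differentiable as often as needed for the expressions below to make sense. Given a function $g$, the iterates are $$P_0(x)=f(x)\frac{g(x)}{g'(x)},\qquad P_{i+1}(x)=f(x)\frac{P_i(x)}{P_i'(x)},\quad i=0,1,2,\dots$$ Put $g_0=g$ and $g_i=P_{i-1}$ for $i\ge1$, so that $P_i=f\,g_i/g_i'$. "$P_i$ is an upper (respectively lower) bound on $F$ on $(l,x_0)$" means that it is obtained as such from the following criterion: $g_i$ is continuous, positive and strictly increasing on $(l,x_0)$ with $g_i'(x)>0$ there, $\lim_{x\to l}P_i(x)=0$, and $P_i'(x)-f(x)\ge 0$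 (respectively $P_i'(x)-f(x)\le 0$) for all $x\in(l,x_0)$; consequently $F(x)\le P_i(x)$ (respectively $F(x)\ge P_i(x)$) for all $x\in(l,x_0)$. *)

theory Defs
  imports "HOL-Probability.Probability"
begin

text \<open>
  The support is the set where the density is nonzero: it contains the open interval
  \<open>(l, r)\<close> and at most the two endpoints besides. Derivatives are taken within the support,
  hence one-sided at an endpoint belonging to it.
\<close>

locale interval_density = prob_space M
  for M :: "'a measure" and X :: "'a \<Rightarrow> real" and f :: "real \<Rightarrow> real" and l r :: ereal +
  assumes l_less_r: "l < r"
    and density_nonneg: "\<And>x. 0 \<le> f x"
    and density: "distributed M lborel X (\<lambda>x. ennreal (f x))"
    and support_lower: "einterval l r \<subseteq> {x. f x \<noteq> 0}"
    and support_upper: "{x. f x \<noteq> 0} \<subseteq> {x. l \<le> ereal x \<and> ereal x \<le> r}"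
    and cdf_deriv: "\<And>x. f x \<noteq> 0 \<Longrightarrow>
      (cdf (distr M borel X) has_real_derivative f x) (at x within {x. f x \<noteq> 0})"
    and density_continuous: "continuous_on {x. f x \<noteq> 0} f"
    and density_differentiable: "f differentiable_on {x. f x \<noteq> 0}"

primrec iter_P :: "(real \<Rightarrow> real) \<Rightarrow> (real \<Rightarrow> real) \<Rightarrow> nat \<Rightarrow> real \<Rightarrow> real" where
  "iter_P f g 0 = (\<lambda>x. f x * (g x / deriv g x))"
| "iter_P f g (Suc i) = (\<lambda>x. f x * (iter_P f g i x / deriv (iter_P f g i) x))"

definition iter_g :: "(real \<Rightarrow> real) \<Rightarrow> (real \<Rightarrow> real) \<Rightarrow> nat \<Rightarrow> real \<Rightarrow> real" where
  "iter_g f g i = (case i of 0 \<Rightarrow> g | Suc j \<Rightarrow> iter_P f g j)"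

lemma iter_P_eq: "iter_P f g i x = f x * (iter_g f g i x / deriv (iter_g f g i) x)"
  by (cases i) (simp_all add: iter_g_def)

text \<open>
  Since \<open>deriv\<close> and division are total, the following says explicitly that
  \<open>P\<^sub>0, \<dots>, P\<^sub>i\<close> and the derivative of \<open>P\<^sub>i\<close> make sense on the open set \<open>S\<close>.
\<close>

definition iterates_defined_on ::
  "real set \<Rightarrow> (real \<Rightarrow> real) \<Rightarrow> (real \<Rightarrow> real) \<Rightarrow> nat \<Rightarrow> bool" where
  "iterates_defined_on S f g i \<longleftrightarrow>
     (\<forall>j\<le>i. \<forall>x\<in>S. iter_g f g j differentiable (at x) \<and> deriv (iter_g f g j) x \<noteq> 0) \<and>
     (\<forall>x\<in>S. iter_P f g i differentiable (at x))"

text \<open>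
  The limit at \<open>l\<close> is taken along \<open>at_right l\<close> in the extended reals, which covers
  \<open>l = -\<infinity>\<close> as well as finite \<open>l\<close>.
\<close>

definition bound_criterion ::
  "(real \<Rightarrow> real) \<Rightarrow> (real \<Rightarrow> real) \<Rightarrow> nat \<Rightarrow> ereal \<Rightarrow> ereal \<Rightarrow> bool" where
  "bound_criterion f g i l x0 \<longleftrightarrow>
     iterates_defined_on (einterval l x0) f g i \<and>
     continuous_on (einterval l x0) (iter_g f g i) \<and>
     (\<forall>x\<in>einterval l x0. 0 < iter_g f g i x) \<and>
     strict_mono_on (einterval l x0) (iter_g f g i) \<and>
     (\<forall>x\<in>einterval l x0. 0 < deriv (iter_g f g i) x) \<and>
     ((iter_P f g i \<circ> real_of_ereal) \<longlongrightarrow> 0) (at_right l)"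

definition is_upper_bound ::
  "(real \<Rightarrow> real) \<Rightarrow> (real \<Rightarrow> real) \<Rightarrow> nat \<Rightarrow> ereal \<Rightarrow> ereal \<Rightarrow> bool" where
  "is_upper_bound f g i l x0 \<longleftrightarrow>
     bound_criterion f g i l x0 \<and>
     (\<forall>x\<in>einterval l x0. deriv (iter_P f g i) x - f x \<ge> 0)"

definition is_lower_bound ::
  "(real \<Rightarrow> real) \<Rightarrow> (real \<Rightarrow> real) \<Rightarrow> nat \<Rightarrow> ereal \<Rightarrow> ereal \<Rightarrow> bool" where
  "is_lower_bound f g i l x0 \<longleftrightarrow>
     bound_criterion f g i l x0 \<and>
     (\<forall>x\<in>einterval l x0. deriv (iter_P f g i) x - f x \<le> 0)"

end

theory Submission
  imports Defs
begin

text \<open>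
  The step from \<open>P\<^sub>i\<close> to \<open>P\<^sub>i\<^sub>+\<^sub>1\<close> is multiplication by the ratio \<open>f / P\<^sub>i'\<close>. The sign of
  \<open>P\<^sub>i' - f\<close>, which decides whether \<open>P\<^sub>i\<close> is an upper or a lower bound, also decides on which side
  of 1 this ratio lies, once \<open>P\<^sub>i' > 0\<close>. Multiplying the comparison with 1 by \<open>P\<^sub>i\<close> keeps its
  direction because \<open>P\<^sub>i = f g\<^sub>i / g\<^sub>i'\<close> is nonnegative. The argument is pointwise.
\<close>

lemma iter_P_Suc_ratio:
  "iter_P f g (Suc i) x = iter_P f g i x * (f x / deriv (iter_P f g i) x)"
  by simp

lemma iter_P_nonneg:
  assumes "bound_criterion f g i l x0" and "x \<in> einterval l x0" and "0 \<le> f x"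
  shows "0 \<le> iter_P f g i x"
  using assms by (simp add: bound_criterion_def iter_P_eq less_imp_le)

theorem lemma8:
  fixes M :: "'a measure" and X :: "'a \<Rightarrow> real" and f g :: "real \<Rightarrow> real"
    and l r x0 xhat0 :: ereal and i :: nat
  assumes "interval_density M X f l r"
    and "l < x0" "x0 \<le> r"
    and "l < xhat0" "xhat0 \<le> r"
    and "iterates_defined_on (einterval l xhat0) f g i"
  shows "(is_upper_bound f g i l x0 \<and> (\<forall>x\<in>einterval l xhat0. deriv (iter_P f g i) x > 0)
            \<longrightarrow> (\<forall>x\<in>einterval l (min x0 xhat0). iter_P f g (Suc i) x \<le> iter_P f g i x)) \<and>
         (is_lower_bound f g i l x0 \<and> (\<forall>x\<in>einterval l xhat0. deriv (iter_P f g i) x > 0)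
            \<longrightarrow> (\<forall>x\<in>einterval l (min x0 xhat0). iter_P f g (Suc i) x \<ge> iter_P f g i x))"
proof -
  interpret interval_density M X f l r by fact
  have in_both: "x \<in> einterval l x0 \<and> x \<in> einterval l xhat0"
    if "x \<in> einterval l (min x0 xhat0)" for x
    using that by (simp add: einterval_def)
  show ?thesis
  proof (intro conjI impI ballI; elim conjE)
    fix x
    assume bound: "is_upper_bound f g i l x0"
      and increasing: "\<forall>x\<in>einterval l xhat0. deriv (iter_P f g i) x > 0"
      and "x \<in> einterval l (min x0 xhat0)"
    then have x: "x \<in> einterval l x0" "x \<in> einterval l xhat0"
      using in_both by auto
    have "0 \<le> iter_P f g i x"
      using bound x(1) density_nonneg by (auto simp: is_upper_bound_def intro: iter_P_nonneg)
    moreover have "f x / deriv (iter_P f g i) x \<le> 1"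
      using bound increasing x by (simp add: is_upper_bound_def)
    ultimately show "iter_P f g (Suc i) x \<le> iter_P f g i x"
      unfolding iter_P_Suc_ratio by (rule mult_left_le[rotated])
  next
    fix x
    assume bound: "is_lower_bound f g i l x0"
      and increasing: "\<forall>x\<in>einterval l xhat0. deriv (iter_P f g i) x > 0"
      and "x \<in> einterval l (min x0 xhat0)"
    then have x: "x \<in> einterval l x0" "x \<in> einterval l xhat0"
      using in_both by auto
    have "0 \<le> iter_P f g i x"
      using bound x(1) density_nonneg by (auto simp: is_lower_bound_def intro: iter_P_nonneg)
    moreover have "1 \<le> f x / deriv (iter_P f g i) x"
      using bound increasing x by (simp add: is_lower_bound_def)
    ultimately show "iter_P f g i x \<le> iter_P f g (Suc i) x"
      unfolding iter_P_Suc_ratio using mult_left_mono[of 1] by fastforce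
  qed
qed

end
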